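(* Let $\tau:[0,1]\to[0,1]$ be a piecewise convex map with countably many branches (in the class described in the context) and let $\{\tau_n\}_{n\ge1}$ be its approximating sequence of maps with finitely many branches. For each $n\in\{1,2,\dots\}$, $\tau_n$ admits an absolutely continuous invariant measure $\mu_n=f_n^*\cdot\lambda$ with non-increasing density function $f_n^*$.
   Context: $I=[0,1]$, $\lambda$ is Lebesgue measure. The map $\tau$: there are points $1=a_0>a_1>a_2>\cdots$ with $\lim_{n\to\infty}a_n=0$ such that $\tau:[0,1]\to[0,1]$ satisfies: (i) for every $j\ge 1$, $\tau|_{[a_j,a_{j-1})}$ is continuous and convex; (ii) $\tau(a_j)=0$ and $\tau'(a_j)>0$ for every $j\ge1$, where $\tau'(a_j)$ is the right derivative; (iii) $\sum_{j\ge 1}\frac{1}{\tau'(a_j)}<\infty$ (equivalently, there is $N\ge1$ with $\sum_{j\ge N+1}\frac1{\tau'(a_j)}<1$). Approximating maps: for $n\ge 1$, $\tau_n(x)=x/a_n$ for $0\le x<a_n$ and $\tau_n(x)=\tau(x)$ for $a_n\le x\le 1$. A density is a function $f\in L^1([0,1],\lambda)$, $f\ge0$, $\int_0^1 f\,d\lambda=1$; $f\cdot\lambda$ denotes the measure $A\mapsto\int_A f\,d\lambda$. A measure $\mu$ is $T$-invariant if $\mu(T^{-1}(A))=\mu(A)$ for all Lebesgue measurable $A\subset[0,1]$. *)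

theory Defs
  imports "HOL-Analysis.Analysis"
begin

definition right_deriv :: "(real \<Rightarrow> real) \<Rightarrow> real \<Rightarrow> real" where
  "right_deriv f x = (THE D. (f has_real_derivative D) (at_right x))"

(* Only the values of \<tau> on [0,1] matter; \<tau> 0 and \<tau> 1 are unconstrained within [0,1].
   The first clause on the right derivative only says that it exists, so that the
   description in right_deriv denotes it; this already follows from convexity,
   \<tau> \<ge> 0 and \<tau> (a j) = 0. *)
locale piecewise_convex_map =
  fixes a :: "nat \<Rightarrow> real" and \<tau> :: "real \<Rightarrow> real"
  assumes a_0: "a 0 = 1"
    and a_decreasing: "\<And>j. a (Suc j) < a j"
    and a_tendsto: "a \<longlonglongrightarrow> 0"
    and maps_to: "\<tau> \<in> {0..1} \<rightarrow> {0..1}"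
    and continuous_branch: "\<And>j. 1 \<le> j \<Longrightarrow> continuous_on {a j..<a (j - 1)} \<tau>"
    and convex_branch: "\<And>j. 1 \<le> j \<Longrightarrow> convex_on {a j..<a (j - 1)} \<tau>"
    and zero_left: "\<And>j. 1 \<le> j \<Longrightarrow> \<tau> (a j) = 0"
    and has_right_deriv:
      "\<And>j. 1 \<le> j \<Longrightarrow> (\<tau> has_real_derivative right_deriv \<tau> (a j)) (at_right (a j))"
    and right_deriv_pos: "\<And>j. 1 \<le> j \<Longrightarrow> 0 < right_deriv \<tau> (a j)"
    and summable_inverse: "summable (\<lambda>j. 1 / right_deriv \<tau> (a (Suc j)))"

definition approx_map :: "(nat \<Rightarrow> real) \<Rightarrow> (real \<Rightarrow> real) \<Rightarrow> nat \<Rightarrow> real \<Rightarrow> real" where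
  "approx_map a \<tau> n x = (if x < a n then x / a n else \<tau> x)"

abbreviation lebesgue01 :: "real measure" where
  "lebesgue01 \<equiv> lebesgue_on {0..1}"

definition density_function :: "(real \<Rightarrow> real) \<Rightarrow> bool" where
  "density_function f \<longleftrightarrow>
     integrable lebesgue01 f \<and> (\<forall>x\<in>{0..1}. 0 \<le> f x) \<and> integral\<^sup>L lebesgue01 f = 1"

(* Measurability of T is required explicitly because emeasure is 0 on non-measurable sets. *)
definition invariant_measure :: "('a \<Rightarrow> 'a) \<Rightarrow> 'a measure \<Rightarrow> bool" where
  "invariant_measure T M \<longleftrightarrow>
     T \<in> measurable M M \<and> (\<forall>A\<in>sets M. emeasure M (T -` A \<inter> space M) = emeasure M A)"

end

theory Submission
  imports Defs "HOL-Complex_Analysis.Great_Picard" "HOL-Probability.Distribution_Functions"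
begin

text \<open>Instead of densities we iterate distribution functions. If \<open>\<phi>\<^sub>i\<close> is the concave inverse of the
  branch on \<open>[c\<^sub>i, c\<^sub>i\<^sub>+\<^sub>1)\<close>, pushing forward by the map sends the distribution function \<open>F\<close> to
  \<open>\<lambda>y. \<Sum>\<^sub>i F (\<phi>\<^sub>i y) - F (c\<^sub>i)\<close>. This preserves concavity, since an increasing concave function of a
  concave function is concave, and, because the branch at 0 has slope greater than 1, it preserves
  \<open>L\<close>-Lipschitz continuity for a suitable \<open>L\<close>. Cesaro averages and the Arzela-Ascoli theorem yield a
  fixed point; being concave and Lipschitz, it has a non-increasing density. Since the \<open>\<phi>\<^sub>i\<close> are
  Lipschitz, preimages of null sets are null, which extends invariance from Borel to Lebesgue
  measurable sets.\<close>

subsection \<open>Inverses of convex branches\<close>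

text \<open>Above the range of the branch this takes the constant value \<open>q\<close>, which keeps it concave.\<close>

definition branch_inverse :: "real \<Rightarrow> real \<Rightarrow> (real \<Rightarrow> real) \<Rightarrow> real \<Rightarrow> real" where
  "branch_inverse p q T y = Sup {x \<in> {p..<q}. T x \<le> y}"

locale expanding_branch =
  fixes p q d :: real and T :: "real \<Rightarrow> real"
  assumes less: "p < q"
    and slope_pos: "0 < d"
    and convex: "convex_on {p..<q} T"
    and left_zero: "T p = 0"
    and le_one: "\<And>x. x \<in> {p..<q} \<Longrightarrow> T x \<le> 1"
    and slope: "\<And>x y. x \<in> {p..<q} \<Longrightarrow> y \<in> {p..<q} \<Longrightarrow> x \<le> y \<Longrightarrow> d * (y - x) \<le> T y - T x"
begin

abbreviation "\<phi> \<equiv> branch_inverse p q T"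

abbreviation sublevel :: "real \<Rightarrow> real set" where
  "sublevel y \<equiv> {x \<in> {p..<q}. T x \<le> y}"

lemma increasing: "x \<in> {p..<q} \<Longrightarrow> y \<in> {p..<q} \<Longrightarrow> x \<le> y \<Longrightarrow> T x \<le> T y"
  using slope[of x y] slope_pos mult_nonneg_nonneg[of d "y - x"] by linarith

lemma strictly_increasing: "x \<in> {p..<q} \<Longrightarrow> y \<in> {p..<q} \<Longrightarrow> x < y \<Longrightarrow> T x < T y"
  using slope[of x y] slope_pos mult_pos_pos[of d "y - x"] by linarith

lemma left_in_sublevel: "0 \<le> y \<Longrightarrow> p \<in> sublevel y"
  using less left_zero by auto

lemma bdd_above_sublevel: "bdd_above (sublevel y)"
  by (rule bdd_aboveI[of _ q]) auto

lemma le_inverse: "x \<in> {p..<q} \<Longrightarrow> T x \<le> y \<Longrightarrow> x \<le> \<phi> y"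
  unfolding branch_inverse_def by (rule cSup_upper[OF _ bdd_above_sublevel]) auto

lemma inverse_le: "0 \<le> y \<Longrightarrow> (\<And>x. x \<in> {p..<q} \<Longrightarrow> T x \<le> y \<Longrightarrow> x \<le> z) \<Longrightarrow> \<phi> y \<le> z"
  unfolding branch_inverse_def by (rule cSup_least) (use left_in_sublevel in blast)+

lemma inverse_bounds: "0 \<le> y \<Longrightarrow> p \<le> \<phi> y" "0 \<le> y \<Longrightarrow> \<phi> y \<le> q"
  using le_inverse[of p y] less left_zero by (auto intro: inverse_le)

text \<open>The supremum need not be attained: once \<open>y\<close> bounds all of \<open>T\<close>,
  it is \<open>q\<close>, which lies outside the half-open branch. Arguments about
  \<open>\<phi> y\<close> therefore go through elements of the sublevel set close to it.\<close>

lemma less_inverseE: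
  assumes "0 \<le> y" "x < \<phi> y"
  obtains z where "z \<in> sublevel y" "x < z"
proof -
  have "sublevel y \<noteq> {}" using left_in_sublevel[OF assms(1)] by blast
  then show ?thesis
    using less_cSupD[of "sublevel y" x] assms(2) that unfolding branch_inverse_def by blast
qed

lemma below_inverse:
  assumes "0 \<le> y" "p \<le> x" "x < \<phi> y" shows "x \<in> sublevel y"
proof -
  obtain z where z: "z \<in> sublevel y" "x < z"
    using assms less_inverseE by blast
  then show ?thesis using increasing[of x z] assms by auto
qed

lemma inverse_mono: "0 \<le> y \<Longrightarrow> y \<le> z \<Longrightarrow> \<phi> y \<le> \<phi> z"
  by (rule inverse_le) (auto intro: le_inverse)

lemma inverse_apply: "x \<in> {p..<q} \<Longrightarrow> \<phi> (T x) = x"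
proof (rule antisym)
  assume x: "x \<in> {p..<q}"
  have "0 \<le> T x" using increasing[of p x] x left_zero by auto
  then show "\<phi> (T x) \<le> x" using strictly_increasing x by (intro inverse_le) force+
qed (auto intro: le_inverse)

lemma inverse_0: "\<phi> 0 = p"
  using inverse_apply[of p] less left_zero by simp

text \<open>Even a branch that is not onto has all of \<open>{p..<q}\<close> as its sublevel set at
  height 1. This is what later preserves total mass.\<close>

lemma inverse_1: "\<phi> 1 = q"
proof (rule antisym)
  show "q \<le> \<phi> 1"
  proof (rule dense_le_bounded[OF less])
    show "x \<le> \<phi> 1" if "p < x" "x < q" for x using that le_one by (intro le_inverse) auto
  qed
qed (simp add: inverse_bounds)

text \<open>Any \<open>w\<close> strictly between \<open>\<phi> y\<close> and a point
  \<open>x\<close> of the sublevel set of \<open>z\<close> satisfies \<open>y < T w\<close> and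
  \<open>T x \<le> z\<close>, so the slope bound gives \<open>d * (x - w) \<le> z - y\<close>. Then
  \<open>w\<close> tends to \<open>\<phi> y\<close>.\<close>

lemma inverse_lipschitz:
  assumes "0 \<le> y" "y \<le> z" shows "\<phi> z - \<phi> y \<le> (z - y) / d"
proof -
  have "\<phi> z \<le> \<phi> y + (z - y) / d"
  proof (rule inverse_le)
    fix x assume x: "x \<in> {p..<q}" "T x \<le> z"
    show "x \<le> \<phi> y + (z - y) / d"
    proof (cases "x \<le> \<phi> y")
      case True
      then show ?thesis using assms slope_pos by (simp add: add_increasing2)
    next
      case False
      have "x - (z - y) / d \<le> \<phi> y"
      proof (rule dense_ge_bounded[of "\<phi> y" x])
        fix w assume w: "\<phi> y < w" "w < x"
        then have w': "w \<in> {p..<q}" using inverse_bounds[OF assms(1)] x by auto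
        then have "y < T w" using le_inverse[of w y] w by force
        then have "d * (x - w) \<le> z - y" using slope[of w x] w w' x by auto
        then show "x - (z - y) / d \<le> w" using slope_pos by (simp add: field_simps)
      qed (use False in auto)
      then show ?thesis by simp
    qed
  qed (use assms in auto)
  then show ?thesis by simp
qed

text \<open>Convexity of \<open>T\<close> puts convex combinations of points of two sublevel sets
  into the sublevel set at the combined height; suprema then inherit the inequality.\<close>

lemma inverse_concave: "concave_on {0..} \<phi>"
  unfolding concave_on_iff
proof (intro conjI ballI allI impI)
  fix y z u v :: real
  assume yz: "y \<in> {0..}" "z \<in> {0..}" and uv: "0 \<le> u" "0 \<le> v" "u + v = 1"
  have comb: "u * s + v * t \<le> \<phi> (u * y + v * z)" if "s \<in> sublevel y" "t \<in> sublevel z" for s t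
  proof (rule le_inverse)
    have "u *\<^sub>R s + v *\<^sub>R t \<in> {p..<q}"
      using that uv by (intro convexD) auto
    then show "u * s + v * t \<in> {p..<q}" by simp
    have "T (u *\<^sub>R s + v *\<^sub>R t) \<le> u * T s + v * T t"
      using convex that uv unfolding convex_on_def by blast
    also have "\<dots> \<le> u * y + v * z"
      using that uv by (intro add_mono mult_left_mono) auto
    finally show "T (u * s + v * t) \<le> u * y + v * z" by simp
  qed
  show "u * \<phi> y + v * \<phi> z \<le> \<phi> (u *\<^sub>R y + v *\<^sub>R z)"
  proof (rule ccontr)
    assume neg: "\<not> ?thesis"
    \<comment> \<open>The gap by which concavity would fail. Points within \<open>e\<close> of both
      suprema already overshoot it.\<close>
    define e where "e = u * \<phi> y + v * \<phi> z - \<phi> (u * y + v * z)"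
    have e: "e > 0" using neg by (simp add: e_def)
    obtain s where s: "s \<in> sublevel y" "\<phi> y - e < s"
      using less_inverseE[of y "\<phi> y - e"] yz e by auto
    obtain t where t: "t \<in> sublevel z" "\<phi> z - e < t"
      using less_inverseE[of z "\<phi> z - e"] yz e by auto
    have "u * (\<phi> y - e) + v * (\<phi> z - e) < u * s + v * t"
    \<comment> \<open>Strictness comes from \<open>s\<close> when \<open>u\<close> is positive, and
      otherwise from \<open>t\<close>, since then \<open>v = 1\<close>.\<close>
    proof (cases "u = 0")
      case True then show ?thesis using uv t by simp
    next
      case False
      then show ?thesis using uv s t
        by (intro add_less_le_mono mult_strict_left_mono mult_left_mono) auto
    qed
    moreover have "u * (\<phi> y - e) + v * (\<phi> z - e) = u * \<phi> y + v * \<phi> z - (u + v) * e"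
      by (simp add: algebra_simps)
    ultimately show False using comb[OF s(1) t(1)] uv by (simp add: e_def)
  qed
qed simp

end

subsection \<open>Concave distribution functions\<close>

text \<open>The Lipschitz clause gives equicontinuity and keeps limits absolutely continuous:
  concavity alone would allow an atom to form at 0. Monotonicity makes the one-sided bound
  sufficient.\<close>

definition concave_cdf :: "real \<Rightarrow> (real \<Rightarrow> real) \<Rightarrow> bool" where
  "concave_cdf L F \<longleftrightarrow> concave_on {0..1} F \<and> mono_on {0..1} F \<and> F 0 = 0 \<and> F 1 = 1 \<and>
     (\<forall>x\<in>{0..1}. \<forall>y\<in>{0..1}. x \<le> y \<longrightarrow> F y - F x \<le> L * (y - x))"

lemma concave_cdfD:
  assumes "concave_cdf L F"
  shows "concave_on {0..1} F" "mono_on {0..1} F" "F 0 = 0" "F 1 = 1"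
    "\<And>x y. 0 \<le> x \<Longrightarrow> x \<le> y \<Longrightarrow> y \<le> 1 \<Longrightarrow> F y - F x \<le> L * (y - x)"
    "\<And>x y. 0 \<le> x \<Longrightarrow> x \<le> y \<Longrightarrow> y \<le> 1 \<Longrightarrow> F x \<le> F y"
  using assms by (auto simp: concave_cdf_def mono_on_def)

text \<open>Every clause is an equation or a non-strict inequality between finitely many values,
  hence survives pointwise limits.\<close>

lemma concave_cdf_limit:
  assumes F: "\<And>k. concave_cdf L (F k)"
    and lim: "\<And>x. x \<in> {0..1} \<Longrightarrow> (\<lambda>k. F k x) \<longlonglongrightarrow> G x"
  shows "concave_cdf L G"
  unfolding concave_cdf_def concave_on_iff
proof (intro conjI ballI allI impI)
  fix x y u v :: real
  assume "x \<in> {0..1}" "y \<in> {0..1}" "0 \<le> u" "0 \<le> v" "u + v = 1"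
  then have *: "u *\<^sub>R x + v *\<^sub>R y \<in> {0..1}" "u * F k x + v * F k y \<le> F k (u *\<^sub>R x + v *\<^sub>R y)" for k
    using concave_cdfD(1)[OF F] convexD[of "{0..1::real}" x y u v]
    unfolding concave_on_iff by auto
  show "u * G x + v * G y \<le> G (u *\<^sub>R x + v *\<^sub>R y)"
  proof (rule LIMSEQ_le[OF _ lim[OF *(1)]])
    show "(\<lambda>k. u * F k x + v * F k y) \<longlonglongrightarrow> u * G x + v * G y"
      by (intro tendsto_intros lim) fact+
  qed (use *(2) in auto)
next
  show "mono_on {0..1} G"
  proof (rule mono_onI)
    fix x y :: real assume "x \<in> {0..1}" "y \<in> {0..1}" "x \<le> y"
    then show "G x \<le> G y"
      by (intro LIMSEQ_le[OF lim lim]) (use concave_cdfD(6)[OF F] in auto)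
  qed
next
  show "G 0 = 0" "G 1 = 1"
    using lim[of 0] lim[of 1] concave_cdfD(3,4)[OF F] by (simp_all add: LIMSEQ_const_iff)
next
  fix x y :: real assume *: "x \<in> {0..1}" "y \<in> {0..1}" "x \<le> y"
  show "G y - G x \<le> L * (y - x)"
    by (rule LIMSEQ_le_const2[OF tendsto_diff[OF lim lim]])
      (use * concave_cdfD(5)[OF F] in auto)
qed simp

text \<open>Every clause is stable under convex combinations, here with equal weights
  \<open>w\<close>.\<close>

lemma concave_cdf_average:
  assumes F: "\<And>k. concave_cdf L (F k)"
  shows "concave_cdf L (\<lambda>x. (\<Sum>k<Suc m. F k x) / real (Suc m))"
proof -
  define w where "w = 1 / real (Suc m)"
  have w: "0 \<le> w" "real (Suc m) * w = 1" by (simp_all add: w_def)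
  have "concave_cdf L (\<lambda>x. (\<Sum>k<Suc m. F k x) * w)"
    unfolding concave_cdf_def concave_on_iff
  proof (intro conjI ballI allI impI)
    fix x y u v :: real
    assume "x \<in> {0..1}" "y \<in> {0..1}" "0 \<le> u" "0 \<le> v" "u + v = 1"
    then have "u * F k x + v * F k y \<le> F k (u *\<^sub>R x + v *\<^sub>R y)" for k
      using concave_cdfD(1)[OF F] unfolding concave_on_iff by auto
    then have "(\<Sum>k<Suc m. u * F k x + v * F k y) * w \<le> (\<Sum>k<Suc m. F k (u *\<^sub>R x + v *\<^sub>R y)) * w"
      using w by (intro mult_right_mono sum_mono)
    then show "u * ((\<Sum>k<Suc m. F k x) * w) + v * ((\<Sum>k<Suc m. F k y) * w)
        \<le> (\<Sum>k<Suc m. F k (u *\<^sub>R x + v *\<^sub>R y)) * w"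
      unfolding sum.distrib sum_distrib_left[symmetric] distrib_right mult.assoc .
  next
    show "mono_on {0..1} (\<lambda>x. (\<Sum>k<Suc m. F k x) * w)"
      by (intro mono_onI mult_right_mono sum_mono) (use w concave_cdfD(6)[OF F] in auto)
  next
    fix x y :: real assume *: "x \<in> {0..1}" "y \<in> {0..1}" "x \<le> y"
    have "((\<Sum>k<Suc m. F k y) - (\<Sum>k<Suc m. F k x)) * w \<le> (\<Sum>k<Suc m. L * (y - x)) * w"
      unfolding sum_subtractf[symmetric]
      by (intro mult_right_mono sum_mono concave_cdfD(5)[OF F]) (use w * in auto)
    also have "\<dots> = L * (y - x) * (real (Suc m) * w)"
      unfolding sum_constant card_lessThan by (simp only: ac_simps)
    finally show "(\<Sum>k<Suc m. F k y) * w - (\<Sum>k<Suc m. F k x) * w \<le> L * (y - x)"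
      unfolding w by (simp only: left_diff_distrib mult_1_right)
  next
    show "(\<Sum>k<Suc m. F k 0) * w = 0" "(\<Sum>k<Suc m. F k 1) * w = 1"
      unfolding concave_cdfD(3,4)[OF F] sum_constant card_lessThan using w by simp_all
  qed simp
  then show ?thesis by (simp only: w_def times_divide_eq_right mult_1_right)
qed

text \<open>The three-chord inequality with denominators cleared, from writing \<open>y\<close> as a
  convex combination of \<open>x\<close> and \<open>z\<close>.\<close>

lemma concave_slope_le:
  fixes F :: "real \<Rightarrow> real"
  assumes F: "concave_on {0..1} F" and "0 \<le> x" "x < y" "y < z" "z \<le> 1"
  shows "(F z - F y) * (y - x) \<le> (F y - F x) * (z - y)"
proof -
  have "(z - y) / (z - x) + (y - x) / (z - x) = 1"
    using assms by (simp add: add_divide_distrib[symmetric])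
  then have "((z - y) / (z - x)) * F x + ((y - x) / (z - x)) * F z
      \<le> F (((z - y) / (z - x)) *\<^sub>R x + ((y - x) / (z - x)) *\<^sub>R z)"
    using assms by (intro F[unfolded concave_on_iff, THEN conjunct2, rule_format]) auto
  also have "((z - y) / (z - x)) *\<^sub>R x + ((y - x) / (z - x)) *\<^sub>R z = y"
    using assms by (simp add: divide_simps, simp add: algebra_simps)
  finally have "((z - y) * F x + (y - x) * F z) / (z - x) \<le> F y"
    by (simp add: add_divide_distrib)
  then have "(z - y) * F x + (y - x) * F z \<le> F y * (z - x)"
    using assms by (subst (asm) pos_divide_le_eq) auto
  then show ?thesis by (simp add: algebra_simps)
qed

text \<open>The chord over \<open>{x..y}\<close> is at most as steep as the one over
  \<open>{0..x}\<close>, whose slope is at most \<open>1 / x\<close> because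
  \<open>F x \<le> 1\<close>. The bound does not involve \<open>L\<close>, so away from 0 it costs
  nothing in the Lipschitz estimate.\<close>

lemma concave_cdf_increment_le:
  assumes F: "concave_cdf L F" and "0 < s" "s \<le> x" "x \<le> y" "y \<le> 1"
  shows "F y - F x \<le> (y - x) / s"
proof (cases "x = y")
  case False
  have "(F y - F x) * (x - 0) \<le> (F x - F 0) * (y - x)"
    by (rule concave_slope_le[OF concave_cdfD(1)[OF F]]) (use assms False in auto)
  also have "\<dots> \<le> 1 * (y - x)"
    using concave_cdfD(3,4)[OF F] concave_cdfD(6)[OF F, of x 1] assms by (intro mult_right_mono) auto
  finally have "(F y - F x) * x \<le> y - x" by simp
  moreover have "(F y - F x) * s \<le> (F y - F x) * x"
    using concave_cdfD(6)[OF F, of x y] assms by (intro mult_left_mono) auto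
  ultimately show ?thesis using assms by (simp add: pos_le_divide_eq)
qed simp

subsection \<open>A fixed distribution function\<close>

locale finite_branches =
  fixes N :: nat and c d :: "nat \<Rightarrow> real" and T :: "real \<Rightarrow> real"
  assumes c_0: "c 0 = 0"
    and c_N: "c N = 1"
    and branch: "\<And>i. i < N \<Longrightarrow> expanding_branch (c i) (c (Suc i)) (d i) T"
    and slope_0: "1 < d 0"
    and maps_to: "T \<in> {0..1} \<rightarrow> {0..1}"
begin

abbreviation inverse_branch :: "nat \<Rightarrow> real \<Rightarrow> real" where
  "inverse_branch i \<equiv> branch_inverse (c i) (c (Suc i)) T"

text \<open>The integrated Frobenius-Perron operator: each summand is the mass that one branch sends
  into \<open>{0..y}\<close>.\<close>

definition transfer :: "(real \<Rightarrow> real) \<Rightarrow> real \<Rightarrow> real" where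
  "transfer F y = (\<Sum>i<N. F (inverse_branch i y) - F (c i))"

section \<open>Order of the partition points\<close>

lemma c_less: "i < N \<Longrightarrow> c i < c (Suc i)"
  using branch expanding_branch.less by blast

lemma c_mono: "i \<le> j \<Longrightarrow> j \<le> N \<Longrightarrow> c i \<le> c j"
proof (induction j rule: dec_induct)
  case (step j)
  then show ?case using c_less[of j] by simp
qed simp

lemma c_bounds: "i \<le> N \<Longrightarrow> 0 \<le> c i" "i \<le> N \<Longrightarrow> c i \<le> 1"
  using c_mono[of 0 i] c_mono[of i N] c_0 c_N by auto

lemma N_pos: "0 < N"
  using c_0 c_N by (cases N) auto

lemma c_pos: "0 < i \<Longrightarrow> i \<le> N \<Longrightarrow> 0 < c i"
  using c_less[of 0] c_mono[of "Suc 0" i] c_0 N_pos by auto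

lemma in_branch:
  assumes "0 \<le> x" "x < 1"
  obtains i where "i < N" "x \<in> {c i..<c (Suc i)}"
proof -
  define k where "k = (LEAST k. x < c k)"
  have k: "x < c k" "k \<le> N"
    unfolding k_def using assms c_N by (auto intro: LeastI[of _ N] Least_le)
  with c_0 assms obtain i where i: "k = Suc i" by (cases k) auto
  have "\<not> x < c i" using not_less_Least[of i "\<lambda>k. x < c k"] i k_def by simp
  then show thesis using that[of i] k i by auto
qed

lemma branches_disjoint: "disjoint_family_on (\<lambda>i. {c i..<c (Suc i)}) {..<N}"
proof -
  have "{c i..<c (Suc i)} \<inter> {c j..<c (Suc j)} = {}" if "i < j" "j < N" for i j
    using c_mono[of "Suc i" j] that by auto
  then show ?thesis
    unfolding disjoint_family_on_def by (metis inf_commute lessThan_iff linorder_neqE_nat)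
qed

lemma inverse_branch_bounds:
  assumes "i < N" "0 \<le> y" shows "0 \<le> inverse_branch i y" "inverse_branch i y \<le> 1"
    "c i \<le> inverse_branch i y" "inverse_branch i y \<le> c (Suc i)"
proof -
  interpret expanding_branch "c i" "c (Suc i)" "d i" T by (rule branch) fact
  show "c i \<le> inverse_branch i y" "inverse_branch i y \<le> c (Suc i)"
    using inverse_bounds assms by auto
  then show "0 \<le> inverse_branch i y" "inverse_branch i y \<le> 1"
    using c_bounds[of i] c_bounds[of "Suc i"] assms by auto
qed

text \<open>A solution \<open>L \<ge> 1\<close> of \<open>L / d 0 + (\<Sum>i\<in>{1..<N}. 1 / (c i * d i)) \<le> L\<close>: the branch at 0 multiplies the
  slope of \<open>F\<close> by at most \<open>1 / d 0 < 1\<close>, and elsewhere concavity bounds the slope of \<open>F\<close> to the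
  right of \<open>c i\<close> by \<open>1 / c i\<close>.\<close>

definition lip_const :: real where
  "lip_const = max 1 ((\<Sum>i\<in>{1..<N}. 1 / (c i * d i)) / (1 - 1 / d 0))"

lemma lip_const_step: "lip_const / d 0 + (\<Sum>i\<in>{1..<N}. 1 / (c i * d i)) \<le> lip_const"
proof -
  have "(\<Sum>i\<in>{1..<N}. 1 / (c i * d i)) / (1 - 1 / d 0) \<le> lip_const"
    by (simp add: lip_const_def)
  moreover have "1 - 1 / d 0 > 0" using slope_0 by simp
  ultimately have "(\<Sum>i\<in>{1..<N}. 1 / (c i * d i)) \<le> lip_const * (1 - 1 / d 0)"
    by (simp only: pos_divide_le_eq)
  then show ?thesis by (simp add: algebra_simps)
qed

text \<open>Concavity and monotonicity hold summand by summand. For the Lipschitz clause the branch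
  at 0 is split off and uses the Lipschitz bound of \<open>F\<close>, while the others use
  \<open>concave_cdf_increment_le\<close> with \<open>s = c i\<close>; \<open>lip_const_step\<close>
  closes the loop.\<close>

lemma transfer_concave_cdf:
  assumes F: "concave_cdf lip_const F"
  shows "concave_cdf lip_const (transfer F)"
  unfolding concave_cdf_def concave_on_iff
proof (intro conjI ballI allI impI)
  fix y z u v :: real
  assume yz: "y \<in> {0..1}" "z \<in> {0..1}" and uv: "0 \<le> u" "0 \<le> v" "u + v = 1"
  have *: "u * (F (inverse_branch i y) - F (c i)) + v * (F (inverse_branch i z) - F (c i))
    \<le> F (inverse_branch i (u *\<^sub>R y + v *\<^sub>R z)) - F (c i)" if i: "i < N" for i
  proof -
    interpret expanding_branch "c i" "c (Suc i)" "d i" T by (rule branch) fact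
    have "0 \<le> u *\<^sub>R y + v *\<^sub>R z" using yz uv by auto
    note b = inverse_branch_bounds[OF i this]
    have "u * F (inverse_branch i y) + v * F (inverse_branch i z)
        \<le> F (u *\<^sub>R inverse_branch i y + v *\<^sub>R inverse_branch i z)"
      using concave_cdfD(1)[OF F] yz uv inverse_branch_bounds[OF i]
      unfolding concave_on_iff by auto
    also have "\<dots> \<le> F (inverse_branch i (u *\<^sub>R y + v *\<^sub>R z))"
    proof (rule concave_cdfD(6)[OF F])
      show "u *\<^sub>R inverse_branch i y + v *\<^sub>R inverse_branch i z \<le> inverse_branch i (u *\<^sub>R y + v *\<^sub>R z)"
        using inverse_concave yz uv unfolding concave_on_iff by auto
    qed (use uv yz inverse_branch_bounds[OF i] b in auto)
    moreover have "u * F (c i) + v * F (c i) = F (c i)"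
      using uv by (simp flip: distrib_right)
    ultimately show ?thesis by (simp add: algebra_simps)
  qed
  show "u * transfer F y + v * transfer F z \<le> transfer F (u *\<^sub>R y + v *\<^sub>R z)"
    unfolding transfer_def sum_distrib_left sum.distrib[symmetric] by (intro sum_mono *) simp
next
  show "mono_on {0..1} (transfer F)"
  proof (rule mono_onI)
    fix y z :: real assume yz: "y \<in> {0..1}" "z \<in> {0..1}" "y \<le> z"
    show "transfer F y \<le> transfer F z" unfolding transfer_def
    proof (rule sum_mono)
      fix i assume "i \<in> {..<N}"
      then have i: "i < N" by simp
      interpret expanding_branch "c i" "c (Suc i)" "d i" T by (rule branch) fact
      show "F (inverse_branch i y) - F (c i) \<le> F (inverse_branch i z) - F (c i)"
        using concave_cdfD(6)[OF F] inverse_branch_bounds[OF i] inverse_mono yz by auto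
    qed
  qed
next
  show "transfer F 0 = 0"
    unfolding transfer_def using expanding_branch.inverse_0[OF branch] by simp
  \<comment> \<open>At height 1 every inverse branch reaches its right endpoint, so the sum
    telescopes over the partition.\<close>
  have "transfer F 1 = (\<Sum>i<N. F (c (Suc i)) - F (c i))"
    unfolding transfer_def using expanding_branch.inverse_1[OF branch] by simp
  also have "\<dots> = 1"
    using sum_lessThan_telescope[of "\<lambda>i. F (c i)" N] concave_cdfD(3,4)[OF F] c_0 c_N by simp
  finally show "transfer F 1 = 1" .
next
  fix y z :: real assume yz: "y \<in> {0..1}" "z \<in> {0..1}" "y \<le> z"
  define D where "D i = F (inverse_branch i z) - F (inverse_branch i y)" for i
  have D_0: "D 0 \<le> lip_const / d 0 * (z - y)"
  proof -
    interpret expanding_branch "c 0" "c (Suc 0)" "d 0" T by (rule branch) (rule N_pos)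
    have "D 0 \<le> lip_const * (inverse_branch 0 z - inverse_branch 0 y)"
      unfolding D_def using inverse_branch_bounds[OF N_pos] inverse_mono yz
      by (intro concave_cdfD(5)[OF F]) auto
    also have "\<dots> \<le> lip_const * ((z - y) / d 0)"
      using inverse_lipschitz yz by (intro mult_left_mono) (auto simp: lip_const_def)
    finally show ?thesis by simp
  qed
  have D_i: "D i \<le> 1 / (c i * d i) * (z - y)" if i: "i \<in> {1..<N}" for i
  proof -
    have i': "i < N" "0 < c i" using i c_pos by auto
    interpret expanding_branch "c i" "c (Suc i)" "d i" T by (rule branch) fact
    have "D i \<le> (inverse_branch i z - inverse_branch i y) / c i"
      unfolding D_def using inverse_branch_bounds[OF i'(1)] inverse_mono yz i'
      by (intro concave_cdf_increment_le[OF F]) auto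
    also have "\<dots> \<le> (z - y) / d i / c i"
      using inverse_lipschitz yz i' by (intro divide_right_mono) auto
    finally show ?thesis by (simp add: mult.commute)
  qed
  have "transfer F z - transfer F y = (\<Sum>i<N. D i)"
    unfolding transfer_def D_def sum_subtractf[symmetric] by simp
  also have "\<dots> = D 0 + (\<Sum>i\<in>{1..<N}. D i)"
    using N_pos by (simp add: lessThan_atLeast0 sum.atLeast_Suc_lessThan)
  also have "\<dots> \<le> lip_const / d 0 * (z - y) + (\<Sum>i\<in>{1..<N}. 1 / (c i * d i) * (z - y))"
    by (intro add_mono sum_mono D_0 D_i)
  also have "\<dots> = (lip_const / d 0 + (\<Sum>i\<in>{1..<N}. 1 / (c i * d i))) * (z - y)"
    unfolding distrib_right sum_distrib_right ..
  also have "\<dots> \<le> lip_const * (z - y)"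
    using lip_const_step yz by (intro mult_right_mono) auto
  finally show "transfer F z - transfer F y \<le> lip_const * (z - y)" .
qed simp

text \<open>Linearity of \<open>transfer\<close>, in the form needed for Cesaro means.\<close>

lemma transfer_average:
  "transfer (\<lambda>x. (\<Sum>k<m. F k x) / r) y = (\<Sum>k<m. transfer (F k) y) / r"
proof -
  have "(\<Sum>k<m. transfer (F k) y) = (\<Sum>i<N. \<Sum>k<m. F k (inverse_branch i y) - F k (c i))"
    unfolding transfer_def by (rule sum.swap)
  then show ?thesis
    unfolding transfer_def by (simp add: sum_subtractf sum_divide_distrib diff_divide_distrib)
qed

text \<open>Lebesgue measure starts the iteration; it satisfies the Lipschitz clause because
  \<open>lip_const\<close> is at least 1.\<close>

lemma concave_cdf_id: "concave_cdf lip_const (\<lambda>x. x)"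
  unfolding concave_cdf_def concave_on_iff
proof (intro conjI ballI allI impI)
  show "y - x \<le> lip_const * (y - x)" if "x \<le> y" for x y :: real
    using that mult_right_mono[of 1 lip_const "y - x"] by (simp add: lip_const_def)
qed (auto intro: mono_onI)

text \<open>The Cesaro means \<open>G m\<close> of an orbit satisfy \<open>transfer (G m) - G m = O(1 / m)\<close>, so every
  limit point is fixed.\<close>

lemma transfer_fixpoint:
  obtains G where "concave_cdf lip_const G" "\<And>y. y \<in> {0..1} \<Longrightarrow> transfer G y = G y"
proof -
  define F where "F k = (transfer ^^ k) (\<lambda>x. x)" for k
  define G where "G m x = (\<Sum>k<Suc m. F k x) / real (Suc m)" for m x
  have F: "concave_cdf lip_const (F k)" for k
    by (induction k) (auto simp: F_def concave_cdf_id transfer_concave_cdf)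
  have G: "concave_cdf lip_const (G m)" for m
    unfolding G_def by (rule concave_cdf_average) (rule F)
  have F_bounds: "0 \<le> F k x" "F k x \<le> 1" if "x \<in> {0..1}" for k x
    using concave_cdfD(3,4)[OF F[of k]] concave_cdfD(6)[OF F[of k], of 0 x]
      concave_cdfD(6)[OF F[of k], of x 1] that by auto
  have G_bounds: "0 \<le> G k x" "G k x \<le> 1" if "x \<in> {0..1}" for k x
    using concave_cdfD(3,4)[OF G[of k]] concave_cdfD(6)[OF G[of k], of 0 x]
      concave_cdfD(6)[OF G[of k], of x 1] that by auto
  have L: "lip_const \<ge> 1" by (simp add: lip_const_def)
  \<comment> \<open>The Lipschitz constant is independent of \<open>m\<close>, which is the
    equicontinuity needed for Arzela-Ascoli.\<close>
  have lip: "norm (G m x - G m y) \<le> lip_const * norm (x - y)" if "x \<in> {0..1}" "y \<in> {0..1}" for m x y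
    using concave_cdfD(5,6)[OF G[of m], of x y] concave_cdfD(5,6)[OF G[of m], of y x] that
    by (cases "x \<le> y") (auto simp: abs_if)
  obtain H k where k: "strict_mono (k :: nat \<Rightarrow> nat)"
    and H: "\<And>e. 0 < e \<Longrightarrow> \<exists>M. \<forall>n x. n \<ge> M \<and> x \<in> {0..1} \<longrightarrow> norm (G (k n) x - H x) < e"
  proof (rule Arzela_Ascoli[of "{0..1::real}" G 1])
    show "norm (G n x) \<le> 1" if "x \<in> {0..1}" for n x
      using G_bounds[OF that] by simp
    show "\<exists>e'>0. \<forall>n y. y \<in> {0..1} \<and> norm (x - y) < e' \<longrightarrow> norm (G n x - G n y) < e"
      if "x \<in> {0..1}" "0 < e" for x e
    proof (intro exI[of _ "e / lip_const"] conjI allI impI)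
      fix n y assume y: "y \<in> {0..1} \<and> norm (x - y) < e / lip_const"
      then have "norm (x - y) * lip_const < e" using L by (simp add: pos_less_divide_eq)
      then show "norm (G n x - G n y) < e"
        using lip[of x y n] y that by (simp add: mult.commute)
    qed (use that L in simp)
  qed (use that in auto)
  have lim: "(\<lambda>n. G (k n) x) \<longlonglongrightarrow> H x" if "x \<in> {0..1}" for x
    by (rule LIMSEQ_I) (use H that in blast)
  have "transfer H y = H y" if y: "y \<in> {0..1}" for y
  proof -
    \<comment> \<open>At fixed \<open>y\<close>, \<open>transfer\<close> only evaluates its argument
      at finitely many points of \<open>{0..1}\<close>, so pointwise convergence passes through
      it.\<close>
    have "(\<lambda>n. transfer (G (k n)) y) \<longlonglongrightarrow> transfer H y"
      unfolding transfer_def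
      by (intro tendsto_intros lim) (use y c_bounds inverse_branch_bounds in auto)
    moreover have "(\<lambda>n. transfer (G (k n)) y - G (k n) y) \<longlonglongrightarrow> 0"
    proof (rule Lim_null_comparison)
      \<comment> \<open>\<open>transfer\<close> shifts the orbit by one index, so only the two end
        terms survive; both lie in \<open>{0..1}\<close>.\<close>
      have step: "transfer (G m) y - G m y = (F (Suc m) y - F 0 y) / real (Suc m)" for m
      proof -
        have "transfer (G m) y = (\<Sum>k<Suc m. F (Suc k) y) / real (Suc m)"
          unfolding G_def transfer_average by (simp add: F_def)
        then show ?thesis unfolding G_def
          using sum_lessThan_telescope[of "\<lambda>k. F k y" "Suc m"]
          by (simp only: diff_divide_distrib[symmetric] sum_subtractf[symmetric])
      qed
      have "norm (transfer (G (k n)) y - G (k n) y) \<le> 1 / real (Suc n)" for n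
      proof -
        have "norm (transfer (G (k n)) y - G (k n) y) = \<bar>F (Suc (k n)) y - F 0 y\<bar> / real (Suc (k n))"
          unfolding step by simp
        also have "\<dots> \<le> 1 / real (Suc n)"
          using F_bounds[OF y, of "Suc (k n)"] F_bounds[OF y, of 0] seq_suble[OF k, of n]
          by (intro frac_le) auto
        finally show ?thesis .
      qed
      then show "\<forall>\<^sub>F n in sequentially. norm (transfer (G (k n)) y - G (k n) y) \<le> 1 / real (Suc n)"
        by (intro always_eventually allI)
      show "(\<lambda>n. 1 / real (Suc n)) \<longlonglongrightarrow> 0"
        using LIMSEQ_inverse_real_of_nat by (simp add: inverse_eq_divide)
    qed
    ultimately have "(\<lambda>n. G (k n) y) \<longlonglongrightarrow> transfer H y"
      using tendsto_diff[of "\<lambda>n. transfer (G (k n)) y" "transfer H y" sequentially] by fastforce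
    then show ?thesis using LIMSEQ_unique lim[OF y] by blast
  qed
  then show thesis using that concave_cdf_limit[OF G lim] by blast
qed

end

subsection \<open>The density of a concave distribution function\<close>

text \<open>Takes the place of differentiation when \<open>f\<close> may jump: \<open>D\<close> will
  be a distribution function minus the integral of its candidate density. The increments over
  \<open>m\<close> equal steps sum to at most \<open>(f 0 - f y) * y / m\<close>.\<close>

lemma eq_0_if_antimono_increments:
  fixes D f :: "real \<Rightarrow> real"
  assumes D_0: "D 0 = 0" and "0 \<le> y"
    and D: "\<And>s t. 0 \<le> s \<Longrightarrow> s \<le> t \<Longrightarrow> t \<le> y \<Longrightarrow> \<bar>D t - D s\<bar> \<le> (f s - f t) * (t - s)"
  shows "D y = 0"
proof -
  \<comment> \<open>On the partition into \<open>m\<close> equal parts the bounds telescope.\<close>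
  have "real m * \<bar>D y\<bar> \<le> (f 0 - f y) * y" if "0 < m" for m
  proof -
    define x where "x k = real k * (y / real m)" for k
    have x: "x 0 = 0" "x m = y" "x (Suc k) - x k = y / real m" for k
      using that by (simp_all add: x_def field_simps)
    have step: "\<bar>D (x (Suc k)) - D (x k)\<bar> \<le> (f (x k) - f (x (Suc k))) * (y / real m)" if "k < m" for k
    proof -
      have "x (Suc k) \<le> real m * (y / real m)"
        unfolding x_def using that assms by (intro mult_right_mono) auto
      then show ?thesis using D[of "x k" "x (Suc k)"] x assms that
        by (auto simp: x_def algebra_simps add_divide_distrib)
    qed
    have "\<bar>D y\<bar> = \<bar>\<Sum>k<m. D (x (Suc k)) - D (x k)\<bar>"
      using sum_lessThan_telescope[of "\<lambda>k. D (x k)" m] x D_0 by simp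
    also have "\<dots> \<le> (\<Sum>k<m. \<bar>D (x (Suc k)) - D (x k)\<bar>)" by (rule sum_abs)
    also have "\<dots> \<le> (\<Sum>k<m. (f (x k) - f (x (Suc k))) * (y / real m))"
      by (intro sum_mono step) simp
    also have "\<dots> = (f 0 - f y) * (y / real m)"
      using sum_lessThan_telescope'[of "\<lambda>k. f (x k)" m] x
      by (simp only: sum_distrib_right[symmetric])
    finally show ?thesis using that by (simp add: field_simps)
  qed
  then have "\<bar>D y\<bar> = 0"
    by (intro real_archimedian_rdiv_eq_0[of _ "(f 0 - f y) * y"])
      (use D[of 0 y] assms in \<open>auto intro: order_trans[OF abs_ge_zero]\<close>)
  then show ?thesis by simp
qed

text \<open>Each chord slope of \<open>G\<close> lies between the values of \<open>f\<close> at the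
  right and left end of the chord. Monotonicity of \<open>f\<close> and the integral formula follow
  from these two bounds.\<close>

lemma concave_cdf_density:
  assumes G: "concave_cdf L G"
  obtains f where "antimono_on {0..1} f" "\<And>x. x \<in> {0..1} \<Longrightarrow> 0 \<le> f x"
    "\<And>y. y \<in> {0..1} \<Longrightarrow> (f has_integral G y) {0..y}"
proof -
  \<comment> \<open>By concavity the supremum of the chord slopes to the right is the right
    derivative. The value 0 at 1, where no such chord exists, keeps \<open>f\<close> non-negative
    and non-increasing.\<close>
  define f where "f x = (if x < 1 then Sup ((\<lambda>y. (G y - G x) / (y - x)) ` {x<..1}) else 0)" for x
  have upper: "G y - G x \<le> f x * (y - x)" if "0 \<le> x" "x \<le> y" "y \<le> 1" for x y
  proof (cases "x = y")
    case False
    have "(G z - G x) / (z - x) \<le> L" if "z \<in> {x<..1}" for z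
      using concave_cdfD(5)[OF G, of x z] that \<open>0 \<le> x\<close> by (simp add: pos_divide_le_eq)
    then have "bdd_above ((\<lambda>y. (G y - G x) / (y - x)) ` {x<..1})"
      by (intro bdd_aboveI2)
    then have "(G y - G x) / (y - x) \<le> f x"
      unfolding f_def using that False by (auto intro!: cSUP_upper)
    then show ?thesis using that False by (simp add: pos_divide_le_eq)
  qed simp
  have lower: "f y * (y - x) \<le> G y - G x" if "0 \<le> x" "x \<le> y" "y \<le> 1" for x y
  proof (cases "x = y \<or> y = 1")
    case True
    then show ?thesis using concave_cdfD(6)[OF G, of x y] that by (auto simp: f_def)
  next
    case False
    have "(G z - G y) / (z - y) \<le> (G y - G x) / (y - x)" if z: "z \<in> {y<..1}" for z
    proof -
      have "(G z - G y) * (y - x) \<le> (G y - G x) * (z - y)"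
        by (rule concave_slope_le[OF concave_cdfD(1)[OF G]]) (use that False z \<open>0 \<le> x\<close> \<open>x \<le> y\<close> in auto)
      then show ?thesis using z False \<open>x \<le> y\<close> by (simp add: divide_simps)
    qed
    then have "f y \<le> (G y - G x) / (y - x)"
      unfolding f_def using that False by (auto intro!: cSUP_least)
    then show ?thesis using that False by (simp add: pos_le_divide_eq)
  qed
  have anti: "f y \<le> f x" if "0 \<le> x" "x \<le> y" "y \<le> 1" for x y
  proof (cases "x = y")
    case False
    then show ?thesis
      using order_trans[OF lower upper, OF that that] that by simp
  qed simp
  have nonneg: "0 \<le> f x" if "x \<in> {0..1}" for x
    using anti[of x 1] that by (simp add: f_def)
  \<comment> \<open>Monotonicity alone yields integrability, whatever the jumps of
    \<open>f\<close>.\<close>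
  have "mono_on {0..1} (\<lambda>x. - f x)" by (auto intro!: mono_onI anti)
  from integrable_neg[OF integrable_on_mono_on[OF this]] have int: "f integrable_on {0..1}" by simp
  define D where "D x = G x - integral {0..x} f" for x
  \<comment> \<open>On \<open>{s..t}\<close> both the increment of \<open>G\<close> and the integral
    of \<open>f\<close> lie between \<open>f t * (t - s)\<close> and
    \<open>f s * (t - s)\<close>.\<close>
  have "D y = 0" if y: "y \<in> {0..1}" for y
  proof (rule eq_0_if_antimono_increments[of D y f])
    fix s t assume st: "0 \<le> s" "s \<le> t" "t \<le> y"
    have int': "f integrable_on {s..t}" "f integrable_on {0..t}"
      by (rule integrable_on_subinterval[OF int]; use st y in auto)+
    have "integral {0..t} f - integral {0..s} f = integral {s..t} f"
      using Henstock_Kurzweil_Integration.integral_combine[of 0 s t f] st int' by simp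
    moreover have "integral {s..t} f \<le> f s * (t - s)"
      using integral_le[OF int'(1) integrable_const_ivl, of "f s"] anti st y by (simp add: mult.commute)
    moreover have "f t * (t - s) \<le> integral {s..t} f"
      using integral_le[OF integrable_const_ivl int'(1), of "f t"] anti st y by (simp add: mult.commute)
    moreover note lower[of s t] upper[of s t]
    ultimately show "\<bar>D t - D s\<bar> \<le> (f s - f t) * (t - s)"
      using st y unfolding D_def left_diff_distrib by auto
  qed (use y concave_cdfD(3)[OF G] in \<open>auto simp: D_def\<close>)
  then have "(f has_integral G y) {0..y}" if "y \<in> {0..1}" for y
    using that integrable_integral[OF integrable_on_subinterval[OF int, of 0 y]] by (auto simp: D_def)
  then show thesis using that[of f] anti nonneg by (auto simp: monotone_on_def)
qed

text \<open>Links the gauge integral that characterises the density to the measure it defines; the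
  indicator of \<open>{0..y}\<close> absorbs the restriction to \<open>{0..1}\<close>.\<close>

lemma emeasure_density_Icc:
  fixes f :: "real \<Rightarrow> real"
  assumes f: "f \<in> borel_measurable lebesgue01" "\<And>x. x \<in> {0..1} \<Longrightarrow> 0 \<le> f x"
    and int: "(f has_integral r) {0..y}" and y: "y \<in> {0..1}"
  shows "emeasure (density lebesgue01 (\<lambda>x. ennreal (f x))) {0..y} = ennreal r"
proof -
  have "{0..y} \<in> sets lebesgue01" using y by (simp add: sets_restrict_space_iff)
  then have "emeasure (density lebesgue01 (\<lambda>x. ennreal (f x))) {0..y}
      = (\<integral>\<^sup>+ x. ennreal (f x) * indicator {0..y} x \<partial>lebesgue01)"
    using f by (intro emeasure_density) auto
  also have "\<dots> = (\<integral>\<^sup>+ x. ennreal (f x) * indicator {0..y} x * indicator {0..1} x \<partial>lebesgue)"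
    by (rule nn_integral_restrict_space) simp
  also have "\<dots> = (\<integral>\<^sup>+ x. ennreal (f x) * indicator {0..y} x \<partial>lborel)"
    unfolding nn_integral_completion
    using y by (intro nn_integral_cong) (auto split: split_indicator)
  also have "\<dots> = ennreal r"
    by (rule nn_integral_has_integral_lebesgue'[OF _ int]) (use y f in auto)
  finally show ?thesis .
qed

subsection \<open>Invariance\<close>

context finite_branches
begin

lemma T_bounds: "x \<in> {0..1} \<Longrightarrow> 0 \<le> T x" "x \<in> {0..1} \<Longrightarrow> T x \<le> 1"
  using maps_to by auto

text \<open>On a branch the sublevel set is an interval whose right endpoint
  \<open>inverse_branch i y\<close> may or may not belong to it. One undecided point affects neither
  measurability nor measure.\<close>

lemma sublevel_between:
  assumes "i < N" "0 \<le> y"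
  shows "{c i..<inverse_branch i y} \<subseteq> {x \<in> {c i..<c (Suc i)}. T x \<le> y}"
    and "{x \<in> {c i..<c (Suc i)}. T x \<le> y} \<subseteq> {c i..inverse_branch i y}"
proof -
  interpret expanding_branch "c i" "c (Suc i)" "d i" T by (rule branch) fact
  show "{c i..<inverse_branch i y} \<subseteq> {x \<in> {c i..<c (Suc i)}. T x \<le> y}"
    using below_inverse[OF assms(2)] by auto
  show "{x \<in> {c i..<c (Suc i)}. T x \<le> y} \<subseteq> {c i..inverse_branch i y}"
    using le_inverse by auto
qed

lemma sublevel_borel:
  assumes "i < N" "0 \<le> y"
  shows "{x \<in> {c i..<c (Suc i)}. T x \<le> y} \<in> sets borel" (is "?S \<in> _")
proof -
  have "?S = {c i..<inverse_branch i y} \<union> (?S \<inter> {inverse_branch i y})"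
    using sublevel_between[OF assms] by fastforce
  also have "\<dots> \<in> sets borel"
    by (intro sets.Un atLeastLessThan_borel borel_closed finite_imp_closed) simp
  finally show ?thesis .
qed

text \<open>The point 1 lies in no branch and has to be listed separately.\<close>

lemma sublevel_eq:
  "{x \<in> {0..1}. T x \<le> y} = (\<Union>i<N. {x \<in> {c i..<c (Suc i)}. T x \<le> y}) \<union> ({1} \<inter> {x. T x \<le> y})"
proof (intro equalityI subsetI)
  fix x assume x: "x \<in> {x \<in> {0..1}. T x \<le> y}"
  show "x \<in> (\<Union>i<N. {x \<in> {c i..<c (Suc i)}. T x \<le> y}) \<union> ({1} \<inter> {x. T x \<le> y})"
  proof (cases "x = 1")
    case False
    then obtain i where "i < N" "x \<in> {c i..<c (Suc i)}" using in_branch[of x] x by auto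
    then show ?thesis using x by blast
  qed (use x in simp)
next
  fix x assume x: "x \<in> (\<Union>i<N. {x \<in> {c i..<c (Suc i)}. T x \<le> y}) \<union> ({1} \<inter> {x. T x \<le> y})"
  show "x \<in> {x \<in> {0..1}. T x \<le> y}"
  proof (cases "x = 1")
    case False
    then obtain i where "i < N" "c i \<le> x" "x < c (Suc i)" "T x \<le> y" using x by auto
    then show ?thesis using c_bounds[of i] c_bounds[of "Suc i"] by auto
  qed (use x in auto)
qed

lemma T_measurable: "T \<in> borel_measurable lebesgue01"
proof (subst borel_measurable_iff_le, intro allI)
  fix y
  have "{x \<in> {0..1}. T x \<le> y} \<in> sets borel"
  proof (cases "0 \<le> y")
    case True
    have "{1} \<inter> {x. T x \<le> y} \<in> sets borel"
      by (intro borel_closed finite_imp_closed) simp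
    moreover have "(\<Union>i<N. {x \<in> {c i..<c (Suc i)}. T x \<le> y}) \<in> sets borel"
      by (intro sets.finite_UN sublevel_borel True) auto
    ultimately show ?thesis unfolding sublevel_eq by (intro sets.Un)
  next
    case False
    then have "{x \<in> {0..1}. T x \<le> y} = {}" using T_bounds by force
    then show ?thesis by (metis sets.empty_sets)
  qed
  then show "{x \<in> space lebesgue01. T x \<le> y} \<in> sets lebesgue01"
    by (auto simp: sets_restrict_space_iff intro: sets_completionI_sets)
qed

text \<open>Apart from the point 1, the preimage is covered by finitely many Lipschitz images of
  \<open>A\<close>.\<close>

lemma negligible_preimage:
  assumes "negligible A" shows "negligible (T -` A \<inter> {0..1})"
proof -
  have "T -` A \<inter> {0..1} \<subseteq> (\<Union>i<N. inverse_branch i ` (A \<inter> {0..})) \<union> {1}"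
  proof
    fix x assume x: "x \<in> T -` A \<inter> {0..1}"
    show "x \<in> (\<Union>i<N. inverse_branch i ` (A \<inter> {0..})) \<union> {1}"
    proof (cases "x = 1")
      case False
      then obtain i where i: "i < N" "x \<in> {c i..<c (Suc i)}" using in_branch[of x] x by auto
      interpret expanding_branch "c i" "c (Suc i)" "d i" T by (rule branch) fact
      have "x = inverse_branch i (T x)" using inverse_apply[OF i(2)] by simp
      moreover have "T x \<in> A \<inter> {0..}" using T_bounds[of x] x by simp
      ultimately have "x \<in> inverse_branch i ` (A \<inter> {0..})" by (rule image_eqI)
      then show ?thesis using i(1) by blast
    qed simp
  qed
  moreover have "negligible (inverse_branch i ` (A \<inter> {0..}))" if "i < N" for i
  proof (rule negligible_locally_Lipschitz_image)
    interpret expanding_branch "c i" "c (Suc i)" "d i" T by (rule branch) fact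
    have "norm (inverse_branch i z - inverse_branch i y) \<le> (1 / d i) * norm (z - y)"
      if "y \<in> {0..}" "z \<in> {0..}" for y z
      using inverse_lipschitz[of y z] inverse_lipschitz[of z y] inverse_mono[of y z] inverse_mono[of z y] that
      by (cases "y \<le> z") auto
    then show "\<exists>U B. open U \<and> y \<in> U \<and>
        (\<forall>z\<in>A \<inter> {0..} \<inter> U. norm (inverse_branch i z - inverse_branch i y) \<le> B * norm (z - y))"
      if "y \<in> A \<inter> {0..}" for y
      using that by (intro exI[of _ UNIV] exI[of _ "1 / d i"]) auto
    show "negligible (A \<inter> {0..})" by (rule negligible_subset[OF assms]) simp
  qed simp
  then have "negligible ((\<Union>i<N. inverse_branch i ` (A \<inter> {0..})) \<union> {1})"
    by (intro negligible_Un negligible_Union) auto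
  ultimately show ?thesis by (rule negligible_subset[rotated])
qed

text \<open>The fixed point equation says that the measure and its push-forward have the same
  distribution function, hence agree on Borel sets. Null sets then extend this to Lebesgue
  measurable sets.\<close>

lemma invariant_density:
  assumes G: "concave_cdf L G" "\<And>y. y \<in> {0..1} \<Longrightarrow> transfer G y = G y"
    and f: "f \<in> borel_measurable lebesgue01" "\<And>x. x \<in> {0..1} \<Longrightarrow> 0 \<le> f x"
    and int: "\<And>y. y \<in> {0..1} \<Longrightarrow> (f has_integral G y) {0..y}"
  shows "invariant_measure T (density lebesgue01 (\<lambda>x. ennreal (f x)))"
proof -
  define M where "M = density lebesgue01 (\<lambda>x. ennreal (f x))"
  have space_M: "space M = {0..1}" and sets_M: "sets M = sets lebesgue01"
    by (simp_all add: M_def)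
  have M_Icc: "emeasure M {0..y} = ennreal (G y)" if "y \<in> {0..1}" for y
    unfolding M_def using f int[OF that] that by (rule emeasure_density_Icc)
  interpret M: prob_space M
    by (rule prob_spaceI) (use M_Icc[of 1] concave_cdfD(4)[OF G(1)] in \<open>simp add: space_M\<close>)
  have G_nonneg: "0 \<le> G y" if "y \<in> {0..1}" for y
    using concave_cdfD(3)[OF G(1)] concave_cdfD(6)[OF G(1), of 0 y] that by auto
  have measure_Icc: "measure M {0..y} = G y" if "y \<in> {0..1}" for y
    using M_Icc[OF that] G_nonneg[OF that] by (simp add: measure_def)
  have ac: "absolutely_continuous lebesgue01 M"
    unfolding M_def using f by (intro absolutely_continuousI_density) auto
  have null: "A \<inter> {0..1} \<in> null_sets M" if "negligible A" for A
  proof -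
    have "A \<inter> {0..1} \<in> null_sets lebesgue01"
      using negligible_subset[OF that, of "A \<inter> {0..1}"]
      by (auto simp: negligible_iff_null_sets null_sets_restrict_space)
    then show ?thesis using ac by (auto simp: absolutely_continuous_def)
  qed
  have AE_finite: "AE x in M. x \<notin> A" if "finite A" for A
    using AE_not_in[OF null[OF negligible_finite[OF that]]] AE_space
    by eventually_elim (auto simp: space_M)
  have borel_M: "A \<inter> {0..1} \<in> sets M" if "A \<in> sets borel" for A
    using that by (auto simp: sets_M sets_restrict_space_iff intro: sets_completionI_sets)
  have id_meas: "(\<lambda>x. x) \<in> M \<rightarrow>\<^sub>M borel"
    by (rule measurableI) (use borel_M in \<open>auto simp: space_M\<close>)
  have T_meas: "T \<in> M \<rightarrow>\<^sub>M borel"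
    using T_measurable by (simp add: M_def)
  have branch_measure: "measure M {x \<in> {c i..<c (Suc i)}. T x \<le> y} = G (inverse_branch i y) - G (c i)"
    (is "measure M ?S = _") if i: "i < N" and y: "0 \<le> y" for i y
  proof -
    note b = inverse_branch_bounds[OF i y] c_bounds[of i]
    have S01: "?S \<subseteq> {0..1}" using c_bounds[of i] c_bounds[of "Suc i"] i by auto
    have Icc: "{0..z} \<in> sets M" if "z \<le> 1" for z :: real
      using borel_M[of "{0..z}"] that by (simp add: Int_absorb2)
    have "measure M ?S = measure M ({0..inverse_branch i y} - {0..c i})"
    proof (rule M.finite_measure_eq_AE)
      \<comment> \<open>The sets can differ only at \<open>c i\<close> and
        \<open>inverse_branch i y\<close>, which carry no mass.\<close>
      show "AE x in M. (x \<in> ?S) = (x \<in> {0..inverse_branch i y} - {0..c i})"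
      proof (rule AE_mp[OF AE_finite[of "{c i, inverse_branch i y}"]], simp, intro AE_I2 impI)
        fix x assume "x \<notin> {c i, inverse_branch i y}"
        then show "(x \<in> ?S) = (x \<in> {0..inverse_branch i y} - {0..c i})" using subsetD[OF sublevel_between(1)[OF i y], of x]
            subsetD[OF sublevel_between(2)[OF i y], of x] b i by auto
      qed
      show "?S \<in> sets M"
        using borel_M[OF sublevel_borel[OF i y]] S01 by (simp only: Int_absorb2)
      show "{0..inverse_branch i y} - {0..c i} \<in> sets M"
        using Icc b i by (intro sets.Diff) auto
    qed
    also have "\<dots> = measure M {0..inverse_branch i y} - measure M {0..c i}"
      using Icc b i by (intro M.finite_measure_Diff) auto
    finally show ?thesis using measure_Icc b i by simp
  qed
  have T_sublevel: "measure M {x \<in> {0..1}. T x \<le> y} = G y" if y: "y \<in> {0..1}" for y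
  proof -
    have y0: "0 \<le> y" using y by simp
    define S where "S i = {x \<in> {c i..<c (Suc i)}. T x \<le> y}" for i
    have S_sets: "S i \<in> sets M" if "i < N" for i
    proof -
      have "S i \<subseteq> {0..1}" using c_bounds[of i] c_bounds[of "Suc i"] that by (auto simp: S_def)
      then show ?thesis
        using borel_M[OF sublevel_borel[OF that y0]] unfolding S_def by (simp only: Int_absorb2)
    qed
    have "{x \<in> {0..1}. T x \<le> y} = T -` {..y} \<inter> space M" by (auto simp: space_M)
    then have "{x \<in> {0..1}. T x \<le> y} \<in> sets M" using measurable_sets[OF T_meas] by simp
    \<comment> \<open>The point 1 is discarded as a null set, leaving the disjoint branches.\<close>
    moreover have "AE x in M. (x \<in> {x \<in> {0..1}. T x \<le> y}) = (x \<in> (\<Union>i<N. S i))"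
      using AE_finite[of "{1}"] unfolding sublevel_eq S_def by auto
    ultimately have "measure M {x \<in> {0..1}. T x \<le> y} = measure M (\<Union>i<N. S i)"
      using S_sets by (intro M.finite_measure_eq_AE) auto
    also have "\<dots> = (\<Sum>i<N. measure M (S i))"
    proof (rule M.finite_measure_finite_Union)
      show "disjoint_family_on S {..<N}"
        by (rule disjoint_family_on_bisimulation[OF branches_disjoint]) (auto simp: S_def)
    qed (use S_sets in auto)
    also have "\<dots> = transfer G y"
      unfolding S_def transfer_def by (intro sum.cong refl branch_measure y0) simp
    finally show ?thesis using G(2)[OF y] by simp
  qed
  \<comment> \<open>\<open>M\<close> lives on Lebesgue sets of \<open>{0..1}\<close>; pushing
    forward along the identity views it as a Borel measure on the line, where distribution functions
    determine measures.\<close>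
  have distr_eq: "distr M borel T = distr M borel (\<lambda>x. x)"
  proof (rule cdf_unique)
    show "real_distribution (distr M borel T)" "real_distribution (distr M borel (\<lambda>x. x))"
      unfolding real_distribution_def real_distribution_axioms_def
      using M.prob_space_distr[OF T_meas] M.prob_space_distr[OF id_meas] by auto
    have "measure M (T -` {..y} \<inter> space M) = measure M ({..y} \<inter> space M)" for y
    proof -
      consider "y < 0" | "y \<in> {0..1}" | "1 < y" by fastforce
      then show ?thesis
      proof cases
        case 1
        then have "T -` {..y} \<inter> {0..1} = {}" "{..y} \<inter> {0..1} = {}" using T_bounds by force+
        then show ?thesis unfolding space_M by (simp only:)
      next
        case 2
        then have "T -` {..y} \<inter> {0..1} = {x \<in> {0..1}. T x \<le> y}" "{..y} \<inter> {0..1} = {0..y}" by auto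
        then show ?thesis using T_sublevel[OF 2] measure_Icc[OF 2] unfolding space_M by (simp only:)
      next
        case 3
        then have "T -` {..y} \<inter> {0..1} = {0..1}" "{..y} \<inter> {0..1} = {0..1}" using T_bounds by force+
        then show ?thesis unfolding space_M by (simp only:)
      qed
    qed
    then show "cdf (distr M borel T) = cdf (distr M borel (\<lambda>x. x))"
      unfolding cdf_def by (auto simp: measure_distr T_meas id_meas)
  qed
  have borel_eq: "emeasure M (T -` A \<inter> {0..1}) = emeasure M (A \<inter> {0..1})" if "A \<in> sets borel" for A
    using arg_cong[OF distr_eq, of "\<lambda>K. emeasure K A"] that
    by (simp add: emeasure_distr T_meas id_meas space_M)
  have main: "T -` A \<inter> {0..1} \<in> sets M \<and> emeasure M (T -` A \<inter> {0..1}) = emeasure M A"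
    if A: "A \<in> sets M" for A
  proof -
    have "A \<in> sets lebesgue" "A \<subseteq> {0..1}" using A by (auto simp: sets_M sets_restrict_space_iff)
    \<comment> \<open>A Lebesgue set is a Borel set \<open>S\<close> together with a part
      \<open>B\<close> of a null set; both \<open>B\<close> and its preimage are null for
      \<open>M\<close>.\<close>
    obtain S B B' where S: "A = S \<union> B" "B \<subseteq> B'" "B' \<in> null_sets lborel" "S \<in> sets lborel"
      by (rule sets_completionE[OF \<open>A \<in> sets lebesgue\<close>])
    from S(4) have S_borel: "S \<in> sets borel" by simp
    have S01: "S \<subseteq> {0..1}" "B \<subseteq> {0..1}" using S(1) \<open>A \<subseteq> {0..1}\<close> by auto
    have neg: "negligible B"
    proof (rule negligible_subset[OF _ S(2)])
      show "negligible B'"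
        using null_sets_completionI[OF S(3)] by (simp add: negligible_iff_null_sets)
    qed
    have null_B: "B \<in> null_sets M" "T -` B \<inter> {0..1} \<in> null_sets M"
      using null[OF neg] null[OF negligible_preimage[OF neg]] S01 by (simp_all add: Int_absorb2)
    have pre_S: "T -` S \<inter> {0..1} \<in> sets M"
      using measurable_sets[OF T_meas S_borel] by (simp add: space_M)
    have S_sets: "S \<in> sets M" using borel_M[OF S_borel] S01 by (simp add: Int_absorb2)
    have eq: "T -` A \<inter> {0..1} = (T -` S \<inter> {0..1}) \<union> (T -` B \<inter> {0..1})" using S(1) by auto
    have "emeasure M (T -` A \<inter> {0..1}) = emeasure M (T -` S \<inter> {0..1})"
      unfolding eq by (rule emeasure_Un_null_set[OF pre_S null_B(2)])
    also have "\<dots> = emeasure M S"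
      using borel_eq[OF S_borel] S01 by (simp add: Int_absorb2)
    also have "\<dots> = emeasure M A"
      unfolding S(1) by (rule emeasure_Un_null_set[OF S_sets null_B(1), symmetric])
    finally show ?thesis using pre_S null_B(2) unfolding eq by auto
  qed
  have "T \<in> M \<rightarrow>\<^sub>M M"
    by (rule measurableI) (use main maps_to in \<open>auto simp: space_M\<close>)
  then show ?thesis
    using main by (simp add: invariant_measure_def space_M flip: M_def)
qed

lemma ex_invariant_density:
  "\<exists>f. density_function f \<and> antimono_on {0..1} f \<and>
    absolutely_continuous lebesgue01 (density lebesgue01 (\<lambda>x. ennreal (f x))) \<and>
    invariant_measure T (density lebesgue01 (\<lambda>x. ennreal (f x)))"
proof -
  obtain G where G: "concave_cdf lip_const G" "\<And>y. y \<in> {0..1} \<Longrightarrow> transfer G y = G y"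
    using transfer_fixpoint by blast
  obtain f where f: "antimono_on {0..1} f" "\<And>x. x \<in> {0..1} \<Longrightarrow> 0 \<le> f x"
    "\<And>y. y \<in> {0..1} \<Longrightarrow> (f has_integral G y) {0..y}"
    using concave_cdf_density[OF G(1)] by blast
  have "mono_on {0..1} (\<lambda>x. - f x)" using f(1) by (auto simp: monotone_on_def)
  from integrable_minus[OF integrable_mono_on[OF this]] have int: "integrable lebesgue01 f" by simp
  have "integral\<^sup>L lebesgue01 f = integral {0..1} f"
    using int by (intro lebesgue_integral_eq_integral) auto
  also have "\<dots> = 1"
    using f(3)[of 1] concave_cdfD(4)[OF G(1)] by (simp add: integral_unique)
  finally have "density_function f"
    using int f(2) by (simp add: density_function_def)
  moreover have meas: "f \<in> borel_measurable lebesgue01" using int by blast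
  then have "absolutely_continuous lebesgue01 (density lebesgue01 (\<lambda>x. ennreal (f x)))"
    by (intro absolutely_continuousI_density) auto
  ultimately show ?thesis
    using f(1) invariant_density[OF G meas f(2,3)] by blast
qed

end

subsection \<open>The approximating maps\<close>

context piecewise_convex_map
begin

lemma a_pos: "0 < a j"
proof -
  have "decseq a" using a_decreasing by (intro decseq_SucI less_imp_le)
  then have "0 \<le> a (Suc j)" using a_tendsto by (rule decseq_ge)
  then show ?thesis using a_decreasing[of j] by linarith
qed

lemma a_le_1: "a j \<le> 1"
  using a_0 lift_Suc_antimono_le[of a 0 j] less_imp_le[OF a_decreasing] by simp

text \<open>By convexity the difference quotients based at \<open>a j\<close> decrease as the second
  point moves left towards \<open>a j\<close>, so their limit is at most the quotient at
  \<open>x\<close>.\<close>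

lemma tangent_le:
  assumes j: "1 \<le> j" and x: "x \<in> {a j<..<a (j - 1)}"
  shows "right_deriv \<tau> (a j) * (x - a j) \<le> \<tau> x"
proof -
  have "right_deriv \<tau> (a j) \<le> \<tau> x / (x - a j)"
  proof (rule tendsto_upperbound)
    show "((\<lambda>w. (\<tau> w - \<tau> (a j)) / (w - a j)) \<longlongrightarrow> right_deriv \<tau> (a j)) (at_right (a j))"
      using has_right_deriv[OF j] by (simp add: has_field_derivative_iff)
    show "\<forall>\<^sub>F w in at_right (a j). (\<tau> w - \<tau> (a j)) / (w - a j) \<le> \<tau> x / (x - a j)"
      unfolding eventually_at_right[OF greaterThanLessThan_iff[THEN iffD1, OF x, THEN conjunct1]]
    proof (intro exI[of _ x] conjI allI impI)
      fix w assume w: "a j < w" "w < x"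
      have "(\<tau> (a j) - \<tau> w) / (a j - w) \<le> (\<tau> (a j) - \<tau> x) / (a j - x)"
        by (rule convex_on_slope_le[OF convex_branch[OF j]]) (use w x in auto)
      then show "(\<tau> w - \<tau> (a j)) / (w - a j) \<le> \<tau> x / (x - a j)"
        using zero_left[OF j] by (metis diff_0 minus_diff_eq minus_divide_divide diff_zero)
    qed (use x in auto)
  qed simp
  then show ?thesis using x by (simp add: pos_le_divide_eq)
qed

text \<open>Convexity makes the chord from \<open>x\<close> to \<open>y\<close> at least as steep as
  the one from \<open>a j\<close> to \<open>x\<close>, which \<open>tangent_le\<close> bounds
  below.\<close>

lemma expanding_branch:
  assumes j: "1 \<le> j"
  shows "expanding_branch (a j) (a (j - 1)) (right_deriv \<tau> (a j)) \<tau>"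
proof
  show "a j < a (j - 1)" using a_decreasing[of "j - 1"] j by simp
  show "\<tau> x \<le> 1" if "x \<in> {a j..<a (j - 1)}" for x
    using maps_to that a_pos[of j] a_le_1[of "j - 1"] by fastforce
  fix x y assume xy: "x \<in> {a j..<a (j - 1)}" "y \<in> {a j..<a (j - 1)}" "x \<le> y"
  show "right_deriv \<tau> (a j) * (y - x) \<le> \<tau> y - \<tau> x"
  proof (cases "x = y \<or> x = a j")
    case True
    then show ?thesis using tangent_le[OF j, of y] zero_left[OF j] xy by (cases "x = y") auto
  next
    case False
    have "right_deriv \<tau> (a j) \<le> \<tau> x / (x - a j)"
      using tangent_le[OF j, of x] xy False by (simp add: pos_le_divide_eq)
    also have "\<dots> = (\<tau> (a j) - \<tau> x) / (a j - x)"
      using zero_left[OF j] by (metis diff_0 minus_diff_eq minus_divide_divide)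
    also have "\<dots> \<le> (\<tau> x - \<tau> y) / (x - y)"
      using convex_on_slope_le[OF convex_branch[OF j], of "a j" y x] xy False by (auto simp: order_less_le)
    also have "\<dots> = (\<tau> y - \<tau> x) / (y - x)"
      by (metis minus_diff_eq minus_divide_divide)
    finally show ?thesis using xy False by (simp add: pos_le_divide_eq)
  qed
qed (use zero_left[OF j] right_deriv_pos[OF j] convex_branch[OF j] in auto)

text \<open>The decreasing points are renumbered as \<open>0 < a n < ... < a 0 = 1\<close>, so that
  branch \<open>i > 0\<close> is \<open>{a j..<a (j - 1)}\<close> with \<open>j = Suc n - i\<close>.
  The linear branch at 0 has slope \<open>1 / a n\<close>, which exceeds 1 because
  \<open>n \<ge> 1\<close> gives \<open>a n < 1\<close>.\<close>

lemma finite_branches_approx_map: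
  assumes n: "1 \<le> n"
  shows "finite_branches (Suc n) (\<lambda>i. if i = 0 then 0 else a (Suc n - i))
    (\<lambda>i. if i = 0 then 1 / a n else right_deriv \<tau> (a (Suc n - i))) (approx_map a \<tau> n)"
proof -
  have an: "0 < a n" "a n < 1"
    using a_pos a_decreasing[of "n - 1"] a_le_1[of "n - 1"] n by auto
  have maps: "approx_map a \<tau> n \<in> {0..1} \<rightarrow> {0..1}"
    using maps_to an by (auto simp: approx_map_def field_simps)
  have branches: "expanding_branch (if i = 0 then 0 else a (Suc n - i)) (a (Suc n - Suc i))
    (if i = 0 then 1 / a n else right_deriv \<tau> (a (Suc n - i))) (approx_map a \<tau> n)"
    if i: "i < Suc n" for i
  proof (cases "i = 0")
    case True
    have "expanding_branch 0 (a n) (1 / a n) (approx_map a \<tau> n)"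
    proof
      show "convex_on {0..<a n} (approx_map a \<tau> n)"
      proof (rule convex_onI)
        fix t x y :: real assume "0 < t" "t < 1" "x \<in> {0..<a n}" "y \<in> {0..<a n}"
        then have "(1 - t) *\<^sub>R x + t *\<^sub>R y \<in> {0..<a n}" by (intro convexD) auto
        then show "approx_map a \<tau> n ((1 - t) *\<^sub>R x + t *\<^sub>R y)
            \<le> (1 - t) * approx_map a \<tau> n x + t * approx_map a \<tau> n y"
          using \<open>x \<in> _\<close> \<open>y \<in> _\<close> by (simp add: approx_map_def add_divide_distrib)
      qed simp
    qed (use an in \<open>auto simp: approx_map_def field_simps\<close>)
    then show ?thesis using True by simp
  next
    case False
    define j where "j = Suc n - i"
    have j: "1 \<le> j" "j \<le> n" "Suc n - Suc i = j - 1" using False i by (auto simp: j_def)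
    interpret br: expanding_branch "a j" "a (j - 1)" "right_deriv \<tau> (a j)" \<tau>
      using j by (intro expanding_branch)
    \<comment> \<open>Every branch other than the first starts at or to the right of
      \<open>a n\<close>, where the approximating map agrees with \<open>\<tau>\<close>.\<close>
    have "a n \<le> a j"
      using lift_Suc_antimono_le[of a j n] less_imp_le[OF a_decreasing] j by simp
    then have eq: "approx_map a \<tau> n x = \<tau> x" if "x \<in> {a j..<a (j - 1)}" for x
      using that by (simp add: approx_map_def)
    have "expanding_branch (a j) (a (j - 1)) (right_deriv \<tau> (a j)) (approx_map a \<tau> n)"
    proof
      show "convex_on {a j..<a (j - 1)} (approx_map a \<tau> n)"
      proof (rule convex_onI)
        fix t x y :: real
        assume *: "0 < t" "t < 1" "x \<in> {a j..<a (j - 1)}" "y \<in> {a j..<a (j - 1)}"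
        then have "(1 - t) *\<^sub>R x + t *\<^sub>R y \<in> {a j..<a (j - 1)}" by (intro convexD) auto
        then show "approx_map a \<tau> n ((1 - t) *\<^sub>R x + t *\<^sub>R y)
            \<le> (1 - t) * approx_map a \<tau> n x + t * approx_map a \<tau> n y"
          using convex_onD[OF br.convex] * eq by simp
      qed simp
      show "approx_map a \<tau> n (a j) = 0" using br.less br.left_zero eq by simp
    qed (use br.less br.slope_pos br.le_one br.slope eq in auto)
    then show ?thesis using False j by (simp add: j_def)
  qed
  show ?thesis
    by (rule finite_branches.intro) (use a_0 an maps branches in simp_all)
qed

end

theorem theorem3:
  fixes a :: "nat \<Rightarrow> real" and \<tau> :: "real \<Rightarrow> real" and n :: nat
  assumes "piecewise_convex_map a \<tau>"
    and "1 \<le> n"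
  shows "\<exists>\<mu> f. density_function f \<and> antimono_on {0..1} f
           \<and> \<mu> = density lebesgue01 (\<lambda>x. ennreal (f x))
           \<and> absolutely_continuous lebesgue01 \<mu>
           \<and> invariant_measure (approx_map a \<tau> n) \<mu>"
  using finite_branches.ex_invariant_density
    [OF piecewise_convex_map.finite_branches_approx_map[OF assms]] by blast

end
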